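(* Let $A\subset\mathbb Z$ be a finite set with $\#A=d$, and let $w_1,\ldots,w_d\in\mathbb C^\times$ satisfy $$\sum_{a\in A}\left(\frac{w_j}{w_i}\right)^a=d\,\delta_{ij},\qquad 1\le i,j\le d.$$ Then $|w_1|=\cdots=|w_d|$.
   Context: $\mathbb C^\times=\mathbb C\setminus\{0\}$; $\delta_{ij}$ is the Kronecker delta (equal to $1$ if $i=j$ and $0$ otherwise); $\#A$ denotes the cardinality of $A$. The exponents $a\in A$ are arbitrary integers, possibly negative. *)

theory Defs
  imports Complex_Main
begin

end

theory Submission
  imports Defs "Jordan_Normal_Form.Determinant"
begin

text \<open>
  Number the points so that \<open>\<bar>v\<^sub>0\<bar> \<le> \<dots> \<le> \<bar>v\<^sub>d\<^sub>-\<^sub>1\<bar>\<close>, let \<open>c\<close> be the least exponent, and consider the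
  partial row sums \<open>Z\<^sub>n(a) = \<Sum>k<n. v\<^sub>k\<^bsup>c-a\<^esup>\<close> together with the weighted energy
  \<open>S(a) = \<Sum>k<d. \<bar>v\<^sub>k\<bar>\<^bsup>2(a-c)\<^esup> (\<bar>Z\<^sub>k\<^sub>+\<^sub>1(a)\<bar>\<^sup>2 - \<bar>Z\<^sub>k(a)\<bar>\<^sup>2)\<close>. The argument evaluates \<open>S\<close> in two ways.

  The weight turns the conjugate of \<open>v\<^sub>k\<^bsup>c-a\<^esup>\<close> into \<open>v\<^sub>k\<^bsup>a-c\<^esup>\<close>. Expanding the squares therefore gives
  \<open>S(a) = \<Sum>k<d. 1 + 2 Re (\<Sum>j<k. (v\<^sub>k/v\<^sub>j)\<^bsup>a-c\<^esup>)\<close>, in which no absolute values are left. Summed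
  over \<open>a \<in> A\<close>, the cross terms vanish by hypothesis and the total is \<open>d\<^sup>2\<close>. The single
  exponent \<open>a = c\<close>, where \<open>Z\<^sub>n(c) = n\<close>, already contributes \<open>d\<^sup>2\<close>; hence the other exponents
  contribute \<open>0\<close> altogether.

  For \<open>a > c\<close>, on the other hand, summation by parts makes \<open>S(a)\<close> nonpositive. The matrix
  \<open>(v\<^sub>k\<^sup>a)\<close> is square, so orthogonality of its columns to those of its entrywise inverse implies
  the same for the rows (\<open>row_orthogonality\<close>), and this says \<open>Z\<^sub>d(a) = 0\<close>. Thus
  \<open>S(a) = - (\<Sum>k<d-1. (\<bar>v\<^sub>k\<^sub>+\<^sub>1\<bar>\<^bsup>2(a-c)\<^esup> - \<bar>v\<^sub>k\<bar>\<^bsup>2(a-c)\<^esup>) \<bar>Z\<^sub>k\<^sub>+\<^sub>1(a)\<bar>\<^sup>2)\<close>, where every bracket is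
  nonnegative because \<open>a > c\<close>.

  All these terms must then vanish. If the absolute value jumps strictly between \<open>v\<^sub>k\<close> and
  \<open>v\<^sub>k\<^sub>+\<^sub>1\<close>, it follows that \<open>Z\<^sub>k\<^sub>+\<^sub>1(a) = 0\<close> for all \<open>a \<noteq> c\<close>. Pairing \<open>Z\<^sub>k\<^sub>+\<^sub>1\<close> with the column of \<open>v\<^sub>0\<close>
  gives \<open>k + 1\<close> (only \<open>a = c\<close> survives) and also \<open>d\<close> (by the hypothesis), which is impossible
  for a jump strictly inside the list.
\<close>

lemma left_inverse_imp_right_inverse:
  fixes P :: "nat \<Rightarrow> 'a \<Rightarrow> 'c :: field" and Q :: "'a \<Rightarrow> nat \<Rightarrow> 'c"
  assumes fin: "finite A" and card: "card A = d"
    and PQ: "\<And>k l. k < d \<Longrightarrow> l < d \<Longrightarrow> (\<Sum>a\<in>A. P k a * Q a l) = (if k = l then 1 else 0)"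
    and a: "a \<in> A" and b: "b \<in> A"
  shows "(\<Sum>k<d. Q a k * P k b) = (if a = b then 1 else 0)"
proof -
  obtain h where h: "bij_betw h {0..<d} A"
    using ex_bij_betw_nat_finite[OF fin] card by blast
  define MP where "MP = mat d d (\<lambda>(k, i). P k (h i))"
  define MQ where "MQ = mat d d (\<lambda>(i, l). Q (h i) l)"
  have carr: "MP \<in> carrier_mat d d" "MQ \<in> carrier_mat d d"
    by (simp_all add: MP_def MQ_def)
  have "MP * MQ = 1\<^sub>m d"
  proof (rule eq_matI)
    fix k l assume kl: "k < dim_row (1\<^sub>m d :: 'c mat)" "l < dim_col (1\<^sub>m d :: 'c mat)"
    have "(MP * MQ) $$ (k, l) = (\<Sum>i\<in>{0..<d}. P k (h i) * Q (h i) l)"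
      using kl by (simp add: MP_def MQ_def scalar_prod_def)
    also have "\<dots> = (\<Sum>a\<in>A. P k a * Q a l)"
      by (rule sum.reindex_bij_betw[OF h])
    finally show "(MP * MQ) $$ (k, l) = 1\<^sub>m d $$ (k, l)"
      using kl PQ by simp
  qed (simp_all add: MP_def MQ_def)
  then have QP: "MQ * MP = 1\<^sub>m d"
    by (rule mat_mult_left_right_inverse[OF carr])
  obtain i j where ij: "i < d" "j < d" "h i = a" "h j = b"
    using h a b unfolding bij_betw_def by (metis atLeastLessThan_iff imageE)
  have "(\<Sum>k<d. Q a k * P k b) = (MQ * MP) $$ (i, j)"
    using ij by (simp add: MP_def MQ_def scalar_prod_def atLeast0LessThan)
  also have "\<dots> = (if a = b then 1 else 0)"
    using QP ij h unfolding bij_betw_def inj_on_def by auto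
  finally show ?thesis .
qed

lemma row_orthogonality:
  fixes v :: "nat \<Rightarrow> 'c :: field_char_0" and A :: "int set"
  assumes fin: "finite A" and card: "card A = d"
    and nz: "\<And>k. k < d \<Longrightarrow> v k \<noteq> 0"
    and orth: "\<And>k l. k < d \<Longrightarrow> l < d \<Longrightarrow>
           (\<Sum>a\<in>A. (v l / v k) powi a) = of_nat d * (if k = l then 1 else 0)"
    and a: "a \<in> A" and b: "b \<in> A" and "a \<noteq> b"
  shows "(\<Sum>k<d. v k powi (a - b)) = 0"
proof -
  have d: "(of_nat d :: 'c) \<noteq> 0"
    using fin card a by (metis card_0_eq empty_iff of_nat_eq_0_iff)
  have PQ: "(\<Sum>a\<in>A. (v k powi (- a) / of_nat d) * v l powi a) = (if k = l then 1 else 0)"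
    if "k < d" "l < d" for k l
  proof -
    have "(\<Sum>a\<in>A. (v k powi (- a) / of_nat d) * v l powi a) = (\<Sum>a\<in>A. (v l / v k) powi a) / of_nat d"
      unfolding sum_divide_distrib
      by (intro sum.cong refl) (simp add: power_int_minus power_int_divide_distrib field_simps)
    then show ?thesis
      using orth[OF that] d by simp
  qed
  have "(\<Sum>k<d. v k powi a * (v k powi (- b) / of_nat d)) = 0"
    using left_inverse_imp_right_inverse[OF fin card, of "\<lambda>k a. v k powi (- a) / of_nat d"
        "\<lambda>a l. v l powi a"] PQ a b \<open>a \<noteq> b\<close> by simp
  moreover have "(\<Sum>k<d. v k powi a * (v k powi (- b) / of_nat d)) = (\<Sum>k<d. v k powi (a - b)) / of_nat d"
    unfolding sum_divide_distrib
    by (intro sum.cong refl) (use nz in \<open>simp add: power_int_diff power_int_minus field_simps\<close>)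
  ultimately show ?thesis
    using d by simp
qed

lemma sum_mult_diff_by_parts:
  fixes r g :: "nat \<Rightarrow> 'c :: comm_ring"
  shows "(\<Sum>k<Suc n. r k * (g (Suc k) - g k)) =
    r n * g (Suc n) - r 0 * g 0 - (\<Sum>k<n. (r (Suc k) - r k) * g (Suc k))"
  by (induction n) (simp_all add: algebra_simps)

text \<open>
  The weight \<open>\<bar>x\<bar>\<^bsup>2m\<^esup>\<close> is the one for which \<open>\<bar>x\<bar>\<^bsup>2m\<^esup> cnj (x\<^bsup>-m\<^esup>) = x\<^sup>m\<close>: it removes the complex
  conjugation from the cross term, so that the bilinear hypothesis applies to it.
\<close>
lemma weighted_norm_increment:
  fixes x y :: complex and m :: int
  assumes x: "x \<noteq> 0"
  shows "norm x powi (2 * m) * ((norm (y + x powi (- m)))\<^sup>2 - (norm y)\<^sup>2) = 1 + 2 * Re (x powi m * y)"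
proof -
  define u where "u = x powi m"
  have u: "u \<noteq> 0" using x by (simp add: u_def)
  have xu: "x powi (- m) = inverse u" "norm x powi (2 * m) = (norm u)\<^sup>2"
    by (simp_all add: u_def power_int_minus norm_power_int power_int_mult mult.commute[of 2 m])
  have "u * (y + inverse u) = u * y + 1"
    using u by (simp add: distrib_left)
  then have "(norm (y + inverse u))\<^sup>2 * (norm u)\<^sup>2 = (norm (u * y + 1))\<^sup>2"
    by (metis norm_mult power_mult_distrib mult.commute)
  moreover have "(norm y)\<^sup>2 * (norm u)\<^sup>2 = (norm (u * y))\<^sup>2"
    by (simp add: norm_mult power_mult_distrib)
  moreover have "(norm (z + 1))\<^sup>2 - (norm z)\<^sup>2 = 1 + 2 * Re z" for z :: complex
    unfolding cmod_power2 by (simp add: power2_eq_square algebra_simps)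
  from this[of "u * y"] have "(norm (u * y + 1))\<^sup>2 - (norm (u * y))\<^sup>2 = 1 + 2 * Re (u * y)" .
  ultimately show ?thesis
    unfolding xu u_def[symmetric] by (simp add: algebra_simps)
qed

text \<open>
  The energies of the exponents above the least one are nonpositive and add up to \<open>0\<close>, so each of
  them vanishes term by term. A jump at position \<open>n\<close> has a positive coefficient there and forces
  \<open>v\<^sub>0\<^bsup>c-a\<^esup> + \<dots> + v\<^sub>n\<^bsup>c-a\<^esup> = 0\<close> for all \<open>a \<noteq> c\<close>, which only the complete sum over all \<open>d\<close> points
  can satisfy.
\<close>
lemma no_norm_jump:
  fixes v :: "nat \<Rightarrow> complex" and A :: "int set"
  assumes fin: "finite A" and card: "card A = d"
    and nz: "\<And>k. k < d \<Longrightarrow> v k \<noteq> 0"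
    and orth: "\<And>k l. k < d \<Longrightarrow> l < d \<Longrightarrow>
           (\<Sum>a\<in>A. (v l / v k) powi a) = of_nat d * (if k = l then 1 else 0)"
    and mono: "\<And>k. Suc k < d \<Longrightarrow> norm (v k) \<le> norm (v (Suc k))"
    and n: "Suc n < d"
  shows "norm (v (Suc n)) = norm (v n)"
proof (rule ccontr)
  assume "norm (v (Suc n)) \<noteq> norm (v n)"
  then have jump: "norm (v n) < norm (v (Suc n))"
    using mono[OF n] by simp
  define c where "c = Min A"
  have "A \<noteq> {}" using card n by auto
  then have c: "c \<in> A" "\<And>a. a \<in> A \<Longrightarrow> c \<le> a"
    using fin by (simp_all add: c_def)
  define Z where "Z = (\<lambda>k a. \<Sum>j<k. v j powi (c - a))"
  define r where "r = (\<lambda>k a. norm (v k) powi (2 * (a - c)))"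
  define S where "S = (\<lambda>a. \<Sum>k<d. r k a * ((norm (Z (Suc k) a))\<^sup>2 - (norm (Z k a))\<^sup>2))"

  have shifted: "(\<Sum>a\<in>A. v l powi (a - c) * v k powi (c - a)) = of_nat d * (if k = l then 1 else 0)"
    if "k < d" "l < d" for k l
  proof -
    have "(\<Sum>a\<in>A. v l powi (a - c) * v k powi (c - a)) = (\<Sum>a\<in>A. (v l / v k) powi a) * (v k / v l) powi c"
      unfolding sum_distrib_right
      by (intro sum.cong refl)
        (use nz that in \<open>simp add: power_int_diff power_int_divide_distrib field_simps\<close>)
    then show ?thesis
      using orth[OF that] nz that by simp
  qed

  have "(\<Sum>a\<in>A. S a) = (\<Sum>k<d. \<Sum>a\<in>A. 1 + 2 * Re (v k powi (a - c) * Z k a))"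
  proof -
    have "r k a * ((norm (Z (Suc k) a))\<^sup>2 - (norm (Z k a))\<^sup>2) = 1 + 2 * Re (v k powi (a - c) * Z k a)"
      if "k < d" for k a
      using weighted_norm_increment[OF nz[OF that], of "a - c" "Z k a"]
      by (simp add: r_def Z_def)
    then show ?thesis
      unfolding S_def by (subst sum.swap) simp
  qed
  also have "\<dots> = (\<Sum>k<d. real d)"
  proof (intro sum.cong refl)
    fix k assume k: "k \<in> {..<d}"
    have "(\<Sum>a\<in>A. v k powi (a - c) * Z k a) = (\<Sum>j<k. \<Sum>a\<in>A. v k powi (a - c) * v j powi (c - a))"
      unfolding Z_def sum_distrib_left by (rule sum.swap)
    also have "\<dots> = 0"
      using k by (intro sum.neutral) (simp add: shifted)
    finally have "(\<Sum>a\<in>A. Re (v k powi (a - c) * Z k a)) = 0"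
      by (metis Re_sum zero_complex.sel(1))
    then show "(\<Sum>a\<in>A. 1 + 2 * Re (v k powi (a - c) * Z k a)) = real d"
      unfolding sum.distrib sum_distrib_left[symmetric] by (simp add: card)
  qed
  finally have total: "(\<Sum>a\<in>A. S a) = (real d)\<^sup>2"
    by (simp add: power2_eq_square)

  obtain e where e: "d = Suc e" using n by (cases d) auto
  have parts: "S a = r e a * (norm (Z d a))\<^sup>2 -
      (\<Sum>k<e. (r (Suc k) a - r k a) * (norm (Z (Suc k) a))\<^sup>2)" for a
    unfolding S_def e by (subst sum_mult_diff_by_parts) (simp add: Z_def)
  have "S c = (real d)\<^sup>2"
    unfolding parts by (simp add: r_def Z_def)
  then have rest: "(\<Sum>a\<in>A - {c}. S a) = 0"
    using total sum.remove[OF fin c(1), of S] by simp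

  have term_nonneg: "0 \<le> (r (Suc k) a - r k a) * (norm (Z (Suc k) a))\<^sup>2"
    if "a \<in> A" "k < e" for a k
    unfolding r_def using that c(2)[OF that(1)] mono[of k] nz[of k] e
    by (intro mult_nonneg_nonneg) (auto intro!: power_int_mono)
  have S_eq: "S a = - (\<Sum>k<e. (r (Suc k) a - r k a) * (norm (Z (Suc k) a))\<^sup>2)"
    if "a \<in> A - {c}" for a
    unfolding parts using row_orthogonality[OF fin card nz orth c(1), of a] that
    by (auto simp: Z_def)
  have Z_zero: "Z (Suc n) a = 0" if a: "a \<in> A - {c}" for a
  proof -
    have "- S a = 0"
    proof (rule sum_nonneg_0[of "A - {c}" "\<lambda>a. - S a"])
      show "0 \<le> - S b" if "b \<in> A - {c}" for b
        using that S_eq[OF that] term_nonneg by (auto intro!: sum_nonneg)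
    qed (use fin rest a in \<open>simp_all add: sum_negf\<close>)
    then have "(\<Sum>k<e. (r (Suc k) a - r k a) * (norm (Z (Suc k) a))\<^sup>2) = 0"
      using S_eq[OF a] by simp
    then have "(r (Suc n) a - r n a) * (norm (Z (Suc n) a))\<^sup>2 = 0"
      using sum_nonneg_0[of "{..<e}" "\<lambda>k. (r (Suc k) a - r k a) * (norm (Z (Suc k) a))\<^sup>2" n]
        term_nonneg a n e by simp
    moreover have "r n a < r (Suc n) a"
      unfolding r_def using a c(2)[of a] jump by (intro power_int_strict_mono) auto
    ultimately show ?thesis by simp
  qed

  (* Any v j with j at most n would do: the pairing picks out the single summand j of Z (Suc n). *)
  have "(\<Sum>a\<in>A. v 0 powi (a - c) * Z (Suc n) a) = of_nat (Suc n)"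
    using sum.remove[OF fin c(1), of "\<lambda>a. v 0 powi (a - c) * Z (Suc n) a"] Z_zero
    by (simp add: Z_def)
  moreover have "(\<Sum>a\<in>A. v 0 powi (a - c) * Z (Suc n) a) =
      (\<Sum>j<Suc n. \<Sum>a\<in>A. v 0 powi (a - c) * v j powi (c - a))"
    unfolding Z_def sum_distrib_left by (rule sum.swap)
  moreover have "\<dots> = (\<Sum>j<Suc n. of_nat d * (if j = 0 then 1 else 0))"
    using n by (intro sum.cong refl shifted) auto
  moreover have "\<dots> = of_nat d"
    by (simp add: sum.delta flip: sum_distrib_left)
  ultimately have "of_nat (Suc n) = (of_nat d :: complex)"
    by metis
  then show False
    using n by (simp only: of_nat_eq_iff)
qed

theorem theorem1p1:
  fixes A :: "int set" and d :: nat and w :: "nat \<Rightarrow> complex"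
  assumes "finite A" and "card A = d"
    and "\<And>i. i \<in> {1..d} \<Longrightarrow> w i \<noteq> 0"
    and "\<And>i j. i \<in> {1..d} \<Longrightarrow> j \<in> {1..d} \<Longrightarrow>
           (\<Sum>a\<in>A. (w j / w i) powi a) = of_nat d * (if i = j then 1 else 0)"
  shows "\<forall>i\<in>{1..d}. \<forall>j\<in>{1..d}. norm (w i) = norm (w j)"
proof -
  define xs where "xs = sort_key (\<lambda>i. norm (w i)) [1..<Suc d]"
  have xs: "length xs = d" "distinct xs" "set xs = {1..d}" "sorted (map (\<lambda>i. norm (w i)) xs)"
    by (auto simp: xs_def)
  define v where "v = (\<lambda>k. w (xs ! k))"
  have mem: "xs ! k \<in> {1..d}" if "k < d" for k
    using that xs nth_mem by blast
  have step: "norm (v (Suc k)) = norm (v k)" if "Suc k < d" for k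
  proof (rule no_norm_jump[OF assms(1,2) _ _ _ that])
    show "v k \<noteq> 0" if "k < d" for k
      using assms(3)[OF mem[OF that]] by (simp add: v_def)
    show "(\<Sum>a\<in>A. (v l / v k) powi a) = of_nat d * (if k = l then 1 else 0)"
      if "k < d" "l < d" for k l
      using assms(4)[OF mem[OF that(1)] mem[OF that(2)]] xs(1,2) that
      by (simp add: v_def nth_eq_iff_index_eq)
    show "norm (v k) \<le> norm (v (Suc k))" if "Suc k < d" for k
      using sorted_nth_mono[OF xs(4), of k "Suc k"] that xs(1) by (simp add: v_def)
  qed
  have const: "norm (v k) = norm (v 0)" if "k < d" for k
    using that by (induction k) (simp_all add: step)
  have "norm (w i) = norm (v 0)" if "i \<in> {1..d}" for i
    using that const xs(1,3) unfolding v_def by (metis in_set_conv_nth)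
  then show ?thesis by simp
qed

end
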